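(* Let $\mathcal{Y}\subseteq\mathbb{A}^2_{\mathbb{Z}[\zeta_3]}$ be the affine curve defined by $y^2=x^6-4x^5+2x^4+6x^3+x^2-10x+1$, where $\zeta_3$ is a primitive cube root of unity. Then \[ \mathcal{Y}(\mathbb{Z}[\zeta_3])=\{(0,\pm1),\ (2,\pm1),\ (1,\pm\sqrt{-3})\}. \]
   Context: $\mathcal{Y}(\mathbb{Z}[\zeta_3])$ is the set of $(x,y)\in\mathbb{Z}[\zeta_3]^2$ satisfying the equation; note $\sqrt{-3}=1+2\zeta_3\in\mathbb{Z}[\zeta_3]$. *)

theory Defs
  imports Complex_Main "HOL-Computational_Algebra.Polynomial"
begin

definition primitive_unity_root :: "nat \<Rightarrow> 'a :: comm_ring_1 \<Rightarrow> bool" where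
  "primitive_unity_root n z \<longleftrightarrow>
     n > 0 \<and> z ^ n = 1 \<and> (\<forall>k. 0 < k \<and> k < n \<longrightarrow> z ^ k \<noteq> 1)"

text \<open>The subring \<open>\<int>[z]\<close> generated by \<open>z\<close>: all values at \<open>z\<close> of polynomials with
  integer coefficients.\<close>

definition int_adjoin :: "'a :: comm_ring_1 \<Rightarrow> 'a set" where
  "int_adjoin z = {poly (map_poly of_int p) z | p :: int poly. True}"

definition Y_points :: "'a :: comm_ring_1 set \<Rightarrow> ('a \<times> 'a) set" where
  "Y_points R = {(x, y). x \<in> R \<and> y \<in> R \<and>
     y ^ 2 = x ^ 6 - 4 * x ^ 5 + 2 * x ^ 4 + 6 * x ^ 3 + x ^ 2 - 10 * x + 1}"

end

theory Submission
  imports Defs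
begin

text \<open>
  Runge's method: with \<open>P = x\<^sup>3 - 2x\<^sup>2 - x + 1\<close> the equation reads \<open>y\<^sup>2 - P\<^sup>2 = 4x(x - 2)\<close>.
  Since 2 is inert in \<open>\<int>[\<zeta>]\<close>, this forces \<open>y = P + 2k\<close> with \<open>k \<in> \<int>[\<zeta>]\<close>, whence
  \<open>k(P + k) = x(x - 2)\<close>. Unless \<open>x(x - 2) = 0\<close>, both factors have absolute value at least 1, so
  \<open>P\<close>, being their difference, is at most of the size of \<open>x(x - 2)\<close>. As \<open>P\<close> is cubic in \<open>x\<close>, this
  bounds \<open>x\<close>, and the few remaining values of \<open>x\<close> are inspected one by one.
\<close>

section \<open>Coordinates and norms in the Eisenstein integers\<close>

lemma primitive_unity_root_3_square:
  fixes z :: "'a :: idom"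
  assumes "primitive_unity_root 3 z"
  shows "z\<^sup>2 = - 1 - z"
proof -
  have "z ^ 3 = 1" "z ^ 1 \<noteq> 1"
    using assms unfolding primitive_unity_root_def by auto
  then have "(z - 1) * (z\<^sup>2 + z + 1) = 0" "z - 1 \<noteq> 0"
    by (auto simp: algebra_simps power2_eq_square power3_eq_cube)
  then have "z\<^sup>2 + z + 1 = 0" by simp
  then show ?thesis by (simp add: algebra_simps eq_neg_iff_add_eq_0)
qed

lemma mult_int_combination:
  fixes z :: "'a :: comm_ring_1"
  assumes "z\<^sup>2 = - 1 - z"
  shows "(of_int a + of_int b * z) * (of_int c + of_int d * z) =
    of_int (a * c - b * d) + of_int (a * d + b * c - b * d) * z"
proof -
  have "(of_int a + of_int b * z) * (of_int c + of_int d * z) =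
    of_int (a * c) + of_int (a * d + b * c) * z + of_int (b * d) * z\<^sup>2"
    by (simp add: algebra_simps power2_eq_square)
  then show ?thesis unfolding assms by (simp add: algebra_simps)
qed

text \<open>Horner's scheme: multiplication by \<open>z\<close> preserves the form
  \<open>a + b * z\<close>, since the quadratic relation eliminates
  \<open>z\<^sup>2\<close>.\<close>

lemma int_adjoin_cases:
  fixes z :: "'a :: comm_ring_1"
  assumes "x \<in> int_adjoin z" and z: "z\<^sup>2 = - 1 - z"
  obtains a b where "x = of_int a + of_int b * z"
proof -
  have "\<exists>a b. poly (map_poly of_int p) z = of_int a + of_int b * z" for p :: "int poly"
  proof (induction p)
    case 0
    then show ?case by (auto intro!: exI[of _ 0])
  next
    case (pCons c p)
    then obtain a b where "poly (map_poly of_int p) z = of_int a + of_int b * z" by blast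
    then have "poly (map_poly of_int (pCons c p)) z = of_int c + z * (of_int a + of_int b * z)"
      by (simp add: map_poly_pCons)
    also have "\<dots> = of_int (c - b) + of_int (a - b) * z"
      using mult_int_combination[OF z, of 0 1 a b] by (simp add: algebra_simps)
    finally show ?case by blast
  qed
  then show ?thesis using assms(1) that unfolding int_adjoin_def by blast
qed

lemma int_combination_in_int_adjoin:
  fixes z :: "'a :: comm_ring_1"
  shows "of_int a + of_int b * z \<in> int_adjoin z"
  unfolding int_adjoin_def
  by (intro CollectI exI[of _ "[:a, b:]"]) (simp add: map_poly_pCons algebra_simps)

context
  fixes z :: complex
  assumes z: "z\<^sup>2 = - 1 - z"
begin

lemma Re_Im_omega: "Re z = - 1 / 2" "(Im z)\<^sup>2 = 3 / 4"
proof -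
  have *: "(Re z)\<^sup>2 - (Im z)\<^sup>2 = - 1 - Re z" "2 * Re z * Im z = - Im z"
    using z by (auto simp: complex_eq_iff power2_eq_square mult_ac)
  \<comment> \<open>A real \<open>z\<close> would be a root of t^2 + t + 1, which is positive on the
    reals.\<close>
  have "Im z \<noteq> 0"
  proof
    assume "Im z = 0"
    then have "(Re z)\<^sup>2 + Re z + 1 = 0" using * by simp
    moreover have "(Re z)\<^sup>2 + Re z + 1 = (Re z + 1 / 2)\<^sup>2 + 3 / 4"
      by (simp add: power2_eq_square algebra_simps)
    ultimately show False using zero_le_power2[of "Re z + 1 / 2"] by linarith
  qed
  moreover have "(2 * Re z + 1) * Im z = 0" using *(2) by (simp add: algebra_simps)
  ultimately show "Re z = - 1 / 2" by simp
  with *(1) show "(Im z)\<^sup>2 = 3 / 4" by (simp add: power2_eq_square)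
qed

lemma int_combination_eq_iff:
  "of_int a + of_int b * z = of_int c + of_int d * z \<longleftrightarrow> a = c \<and> b = d"
proof -
  have "Im z \<noteq> 0" using Re_Im_omega(2) by auto
  then show ?thesis by (auto simp: complex_eq_iff)
qed

lemma cmod_int_combination:
  "(cmod (of_int a + of_int b * z))\<^sup>2 = of_int (a\<^sup>2 - a * b + b\<^sup>2)"
proof -
  have "(cmod (of_int a + of_int b * z))\<^sup>2 =
      (of_int a + of_int b * Re z)\<^sup>2 + (of_int b)\<^sup>2 * (Im z)\<^sup>2"
    by (simp add: cmod_power2 power_mult_distrib)
  then show ?thesis unfolding Re_Im_omega by (simp add: power2_eq_square field_simps)
qed

text \<open>The squared absolute value is an integer, so being positive it is at least 1. This
  discreteness is what Runge's method exploits.\<close>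

lemma cmod_int_combination_ge_1:
  assumes "of_int a + of_int b * z \<noteq> 0"
  shows "1 \<le> (cmod (of_int a + of_int b * z))\<^sup>2"
proof -
  have "0 < (cmod (of_int a + of_int b * z))\<^sup>2" using assms by simp
  then show ?thesis unfolding cmod_int_combination by (simp only: of_int_0_less_iff of_int_1_le_iff)
qed

end

text \<open>The hypotheses say that 2 divides both coordinates of (p + q zeta)^2. The second makes
  \<open>q\<close> even, and then the first makes \<open>p\<close> even.\<close>

lemma even_of_even_eisenstein_square:
  fixes p q :: int
  assumes "even (p\<^sup>2 - q\<^sup>2)" "even (2 * p * q - q\<^sup>2)"
  shows "even p \<and> even q"
  using assms by auto

section \<open>Absolute value estimates bounding x\<close>

lemma cmod_add_power2_le: "(cmod (u + v))\<^sup>2 \<le> 2 * (cmod u)\<^sup>2 + 2 * (cmod v)\<^sup>2"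
proof -
  have "(cmod (u + v))\<^sup>2 \<le> (cmod u + cmod v)\<^sup>2"
    by (simp add: norm_triangle_ineq)
  then show ?thesis
    using zero_le_power2[of "cmod u - cmod v"] by (simp add: power2_sum power2_diff)
qed

text \<open>If A, B \<ge> 1, then (A - 1)(B - 1) \<ge> 0 gives A + B \<le> 1 + AB. The intended use
  is u = P + k and v = k, with u - v = P and uv = x(x - 2).\<close>

lemma cmod_diff_power2_le_prod:
  assumes "1 \<le> (cmod u)\<^sup>2" "1 \<le> (cmod v)\<^sup>2"
  shows "(cmod (u - v))\<^sup>2 \<le> 2 + 2 * (cmod (u * v))\<^sup>2"
proof -
  have "0 \<le> ((cmod u)\<^sup>2 - 1) * ((cmod v)\<^sup>2 - 1)" using assms by simp
  then have "(cmod u)\<^sup>2 + (cmod v)\<^sup>2 \<le> 1 + (cmod (u * v))\<^sup>2"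
    by (simp add: algebra_simps norm_mult)
  then show ?thesis using cmod_add_power2_le[of u "- v"] by simp
qed

lemma runge_bound:
  fixes x :: complex
  assumes "(cmod (x ^ 3 - 2 * x\<^sup>2 - x + 1))\<^sup>2 \<le> 2 + 2 * (cmod (x * (x - 2)))\<^sup>2"
    and "1 \<le> (cmod (x - 2))\<^sup>2"
  shows "(cmod x)\<^sup>2 < 9"
proof (rule ccontr)
  define n t where "n = (cmod x)\<^sup>2" and "t = (cmod (x - 2))\<^sup>2"
  assume "\<not> (cmod x)\<^sup>2 < 9"
  then have n: "9 \<le> n" by (simp add: n_def)
  \<comment> \<open>Adding x - 1 to the cubic P exposes the factor x - 2, which also occurs in the
    upper bound, so both sides can be compared through \<open>t\<close>.\<close>
  have "x\<^sup>2 * (x - 2) = (x ^ 3 - 2 * x\<^sup>2 - x + 1) + (x - 1)"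
    by (simp add: algebra_simps power2_eq_square power3_eq_cube)
  then have "(cmod (x\<^sup>2 * (x - 2)))\<^sup>2 \<le>
      2 * (cmod (x ^ 3 - 2 * x\<^sup>2 - x + 1))\<^sup>2 + 2 * (cmod (x - 1))\<^sup>2"
    using cmod_add_power2_le by metis
  moreover have "(cmod (x - 1))\<^sup>2 \<le> 2 * n + 2"
    using cmod_add_power2_le[of x "- 1"] by (simp add: n_def)
  ultimately have "n\<^sup>2 * t \<le> 4 + 4 * (n * t) + 2 * (2 * n + 2)"
    using assms(1) by (simp add: n_def t_def norm_mult norm_power power_mult_distrib)
  then have "(n * (n - 4)) * t \<le> 8 + 4 * n" by (simp add: algebra_simps power2_eq_square)
  moreover have "(n * (n - 4)) * 1 \<le> (n * (n - 4)) * t"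
    using n assms(2) by (intro mult_left_mono) (auto simp: t_def)
  \<comment> \<open>This fails from 9 on, whence the bound in the lemma.\<close>
  ultimately have "n * (n - 8) \<le> 8" by (simp add: algebra_simps)
  moreover have "9 * 1 \<le> n * (n - 8)" using n by (intro mult_mono) auto
  ultimately show False by simp
qed

section \<open>The finite search\<close>

lemma eisenstein_norm_less_9:
  fixes a b :: int
  assumes "a\<^sup>2 - a * b + b\<^sup>2 < 9"
  shows "a \<in> {-3, -2, -1, 0, 1, 2, 3}" "b \<in> {-3, -2, -1, 0, 1, 2, 3}"
proof -
  have "b \<in> {-3, -2, -1, 0, 1, 2, 3}" if "a\<^sup>2 - a * b + b\<^sup>2 < 9" for a b :: int
  proof -
    \<comment> \<open>Four times the norm form, with the square completed. The form is symmetric, so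
      the bound on \<open>b\<close> serves for \<open>a\<close> too.\<close>
    have "(2 * a - b)\<^sup>2 + 3 * b\<^sup>2 < 36"
      using that by (simp add: power2_eq_square algebra_simps)
    then have "b\<^sup>2 < 4\<^sup>2" using zero_le_power2[of "2 * a - b"] unfolding power2_eq_square by linarith
    then have "\<bar>b\<bar> < 4" using power2_less_imp_less[of "\<bar>b\<bar>" 4] by simp
    then show ?thesis by auto
  qed
  from this[of a b] this[of b a] assms
  show "a \<in> {-3, -2, -1, 0, 1, 2, 3}" "b \<in> {-3, -2, -1, 0, 1, 2, 3}"
    by (simp_all add: algebra_simps)
qed

text \<open>Coordinates with respect to 1 and zeta: (a, b) for x, (c, d) for y, (s, r) for x^2, (p,
  q) for P and (s - 2a, r - 2b) for x(x - 2). The last two hypotheses encode y^2 = P^2 + 4x(x -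
  2).\<close>

lemma small_solutions:
  fixes a b c d s r p q :: int
  assumes s: "s = a\<^sup>2 - b\<^sup>2" and r: "r = 2 * a * b - b\<^sup>2"
    and p: "p = s * (a - 2) - r * b - (a - 1)" and q: "q = s * b + r * (a - 2) - r * b - b"
    and small: "a\<^sup>2 - a * b + b\<^sup>2 < 9"
    and runge: "p\<^sup>2 - p * q + q\<^sup>2 \<le> 2 + 2 * ((s - 2 * a)\<^sup>2 - (s - 2 * a) * (r - 2 * b) + (r - 2 * b)\<^sup>2)"
    and c: "c\<^sup>2 - d\<^sup>2 = p\<^sup>2 - q\<^sup>2 + 4 * (s - 2 * a)"
    and d: "2 * c * d - d\<^sup>2 = 2 * p * q - q\<^sup>2 + 4 * (r - 2 * b)"
  shows "b = 0 \<and> a \<in> {0, 1, 2}"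
proof -
  \<comment> \<open>Among the 49 candidate pairs, the two inequalities leave only these; the
    equation for y^2 has to exclude the last five.\<close>
  have "b = 0 \<and> a \<in> {0, 1, 2} \<or> (a, b) \<in> {(-1, -1), (-1, 0), (0, -1), (0, 1), (1, 1)}"
    using eisenstein_norm_less_9[OF small] small runge unfolding p q s r
    by (elim insertE emptyE; simp)
  moreover have False if "(a, b) \<in> {(-1, -1), (0, -1), (0, 1), (1, 1)}"
  proof -
    \<comment> \<open>the norm of \<open>y\<^sup>2\<close> is 193 or 201, which is not a square in \<open>\<int>\<close>\<close>
    define n where "n = \<bar>c\<^sup>2 - c * d + d\<^sup>2\<bar>"
    \<comment> \<open>The norm is multiplicative: the norm of y^2 is the square of the norm of
      y.\<close>
    have "n\<^sup>2 = (c\<^sup>2 - d\<^sup>2)\<^sup>2 - (c\<^sup>2 - d\<^sup>2) * (2 * c * d - d\<^sup>2) + (2 * c * d - d\<^sup>2)\<^sup>2"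
      unfolding n_def power2_abs by algebra
    then have "n\<^sup>2 = 201 \<or> n\<^sup>2 = 193"
      using that unfolding c d p q s r by auto
    then have "13\<^sup>2 < n\<^sup>2 \<and> n\<^sup>2 < 15\<^sup>2" "n \<noteq> 14" by auto
    moreover have "0 \<le> n" by (simp add: n_def)
    ultimately show False using power2_less_imp_less[of 13 n] power2_less_imp_less[of n 15] by simp
  qed
  \<comment> \<open>Here y^2 = 13 has norm 13^2, so the norm test is inconclusive and the
    coordinates are solved directly.\<close>
  moreover have False if "(a, b) = (-1, 0)"
  proof -
    have c: "c\<^sup>2 - d\<^sup>2 = 13" and "2 * c * d - d\<^sup>2 = 0"
      using that c d unfolding p q s r by auto
    then have "d * (2 * c - d) = 0" by (simp add: algebra_simps power2_eq_square)
    then consider "d = 0" | "d = 2 * c" by auto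
    then show False
    proof cases
      case 1
      then have "\<bar>c\<bar>\<^sup>2 = 13" using c by simp
      then have "3\<^sup>2 < \<bar>c\<bar>\<^sup>2" "\<bar>c\<bar>\<^sup>2 < 4\<^sup>2" by auto
      then show False using power2_less_imp_less[of 3 "\<bar>c\<bar>"] power2_less_imp_less[of "\<bar>c\<bar>" 4] by simp
    next
      case 2
      then have "- 3 * c\<^sup>2 = 13" using c by (simp add: power_mult_distrib)
      then show False using zero_le_power2[of c] by linarith
    qed
  qed
  ultimately show ?thesis by auto
qed

theorem theorem7p5:
  fixes \<zeta> :: complex
  assumes "primitive_unity_root 3 \<zeta>"
  shows "Y_points (int_adjoin \<zeta>) =
    {(0, 1), (0, -1), (2, 1), (2, -1), (1, 1 + 2 * \<zeta>), (1, -(1 + 2 * \<zeta>))}"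
proof -
  note z = primitive_unity_root_3_square[OF assms]
  note mult = mult_int_combination[OF z]
  have sqrt: "(1 + 2 * \<zeta>)\<^sup>2 = - 3"
    using z by (simp add: power2_sum power_mult_distrib)
  have x_cases: "x \<in> {0, 1, 2}"
    if xR: "x \<in> int_adjoin \<zeta>" and yR: "y \<in> int_adjoin \<zeta>"
      and eq: "y ^ 2 = x ^ 6 - 4 * x ^ 5 + 2 * x ^ 4 + 6 * x ^ 3 + x ^ 2 - 10 * x + 1" for x y
  proof (rule ccontr)
    assume x: "x \<notin> {0, 1, 2}"
    obtain a b where ab: "x = of_int a + of_int b * \<zeta>" using int_adjoin_cases[OF xR z] .
    obtain c d where cd: "y = of_int c + of_int d * \<zeta>" using int_adjoin_cases[OF yR z] .
    \<comment> \<open>P is the polynomial part of the square root of the sextic at infinity, so the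
      remainder has degree below 3.\<close>
    define P where "P = x ^ 3 - 2 * x\<^sup>2 - x + 1"
    define s r where s: "s = a\<^sup>2 - b\<^sup>2" and r: "r = 2 * a * b - b\<^sup>2"
    define p q where p: "p = s * (a - 2) - r * b - (a - 1)"
      and q: "q = s * b + r * (a - 2) - r * b - b"
    have eq: "y\<^sup>2 = P\<^sup>2 + 4 * (x * (x - 2))"
      unfolding P_def eq by algebra
    have x2: "x - 2 = of_int (a - 2) + of_int b * \<zeta>" by (simp add: ab)
    have sq: "x\<^sup>2 = of_int s + of_int r * \<zeta>"
      unfolding power2_eq_square ab mult s r by (simp add: algebra_simps)
    have Q: "x * (x - 2) = of_int (s - 2 * a) + of_int (r - 2 * b) * \<zeta>"
      using sq by (simp add: ab algebra_simps power2_eq_square)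
    have "P = x\<^sup>2 * (x - 2) - (x - 1)"
      unfolding P_def by (simp add: algebra_simps power2_eq_square power3_eq_cube)
    then have P: "P = of_int p + of_int q * \<zeta>"
      unfolding sq x2 mult p q by (simp add: ab algebra_simps)
    have "of_int (c\<^sup>2 - d\<^sup>2) + of_int (2 * c * d - d\<^sup>2) * \<zeta> = y\<^sup>2"
      unfolding power2_eq_square cd mult by (simp add: algebra_simps)
    also have "\<dots> = of_int (p\<^sup>2 - q\<^sup>2 + 4 * (s - 2 * a)) +
        of_int (2 * p * q - q\<^sup>2 + 4 * (r - 2 * b)) * \<zeta>"
      unfolding eq Q unfolding power2_eq_square P mult by (simp add: algebra_simps)
    finally have c: "c\<^sup>2 - d\<^sup>2 = p\<^sup>2 - q\<^sup>2 + 4 * (s - 2 * a)"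
      and d: "2 * c * d - d\<^sup>2 = 2 * p * q - q\<^sup>2 + 4 * (r - 2 * b)"
      unfolding int_combination_eq_iff[OF z] by blast+
    \<comment> \<open>First coordinate of (y - P)^2 = 2(2x(x - 2) + P^2 - yP); the second follows.
      Hence 2 divides (y - P)^2 and so y - P.\<close>
    have "(c - p)\<^sup>2 - (d - q)\<^sup>2 = 2 * (2 * (s - 2 * a) + p\<^sup>2 - q\<^sup>2 - c * p + d * q)"
      using c by (simp add: power2_eq_square algebra_simps)
    moreover have "2 * (c - p) * (d - q) - (d - q)\<^sup>2 =
        2 * (2 * (r - 2 * b) + 2 * p * q - q\<^sup>2 - c * q - d * p + d * q)"
      using d by (simp add: power2_eq_square algebra_simps)
    ultimately have "even (c - p) \<and> even (d - q)"
      by (intro even_of_even_eisenstein_square) (metis dvd_triv_left)+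
    then obtain e f where "c = p + 2 * e" "d = q + 2 * f"
      by (metis add.commute diff_add_cancel dvdE)
    define k where "k = of_int e + of_int f * \<zeta>"
    have y: "y = P + 2 * k"
      unfolding cd P k_def \<open>c = _\<close> \<open>d = _\<close> by (simp add: algebra_simps)
    then have "4 * ((P + k) * k) = 4 * (x * (x - 2))"
      using eq by (simp add: power2_eq_square algebra_simps)
    then have prod: "(P + k) * k = x * (x - 2)" by simp
    then have "k \<noteq> 0" "P + k \<noteq> 0" using x by auto
    moreover have "P + k = of_int (p + e) + of_int (q + f) * \<zeta>"
      unfolding P k_def by (simp add: algebra_simps)
    ultimately have "1 \<le> (cmod k)\<^sup>2" "1 \<le> (cmod (P + k))\<^sup>2"
      using cmod_int_combination_ge_1[OF z] unfolding k_def by metis+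
    then have bound: "(cmod P)\<^sup>2 \<le> 2 + 2 * (cmod (x * (x - 2)))\<^sup>2"
      using cmod_diff_power2_le_prod[of "P + k" k] by (simp add: prod)
    have "1 \<le> (cmod (x - 2))\<^sup>2"
      using x x2 cmod_int_combination_ge_1[OF z] by (metis eq_iff_diff_eq_0 insertCI)
    then have "(cmod x)\<^sup>2 < 9"
      using runge_bound bound unfolding P_def by blast
    then have small: "a\<^sup>2 - a * b + b\<^sup>2 < 9"
      unfolding ab cmod_int_combination[OF z] by linarith
    have runge: "p\<^sup>2 - p * q + q\<^sup>2 \<le>
        2 + 2 * ((s - 2 * a)\<^sup>2 - (s - 2 * a) * (r - 2 * b) + (r - 2 * b)\<^sup>2)"
      using bound unfolding P Q cmod_int_combination[OF z] by linarith
    have "b = 0 \<and> a \<in> {0, 1, 2}"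
      using small_solutions[OF s r p q small runge c d] .
    then show False using x by (auto simp: ab)
  qed
  have x0: "y\<^sup>2 = 1 \<longleftrightarrow> y = 1 \<or> y = - 1" for y :: complex
    by (rule power2_eq_1_iff)
  have x1: "y\<^sup>2 = - 3 \<longleftrightarrow> y = 1 + 2 * \<zeta> \<or> y = - (1 + 2 * \<zeta>)" for y
    unfolding sqrt[symmetric] by (rule power2_eq_iff)
  have R: "0 \<in> int_adjoin \<zeta>" "1 \<in> int_adjoin \<zeta>" "2 \<in> int_adjoin \<zeta>" "- 1 \<in> int_adjoin \<zeta>"
    "1 + 2 * \<zeta> \<in> int_adjoin \<zeta>" "- (1 + 2 * \<zeta>) \<in> int_adjoin \<zeta>"
    using int_combination_in_int_adjoin[of 0 0 \<zeta>] int_combination_in_int_adjoin[of 1 0 \<zeta>]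
      int_combination_in_int_adjoin[of 2 0 \<zeta>] int_combination_in_int_adjoin[of "- 1" 0 \<zeta>]
      int_combination_in_int_adjoin[of 1 2 \<zeta>] int_combination_in_int_adjoin[of "- 1" "- 2" \<zeta>]
    by simp_all
  show ?thesis
  proof (intro equalityI subrelI)
    fix x y :: complex
    assume "(x, y) \<in> Y_points (int_adjoin \<zeta>)"
    then have eq: "y ^ 2 = x ^ 6 - 4 * x ^ 5 + 2 * x ^ 4 + 6 * x ^ 3 + x ^ 2 - 10 * x + 1"
      and "x \<in> {0, 1, 2}" using x_cases unfolding Y_points_def by blast+
    \<comment> \<open>The right-hand side is P^2 + 4x(x - 2), with P = 1, -1, -1 at x = 0, 1,
      2.\<close>
    then consider "x = 0" "y\<^sup>2 = 1" | "x = 1" "y\<^sup>2 = - 3" | "x = 2" "y\<^sup>2 = 1" by auto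
    then show "(x, y) \<in>
        {(0, 1), (0, - 1), (2, 1), (2, - 1), (1, 1 + 2 * \<zeta>), (1, - (1 + 2 * \<zeta>))}"
      by cases (simp_all only: x0 x1, auto)
  next
    fix x y :: complex
    assume "(x, y) \<in>
        {(0, 1), (0, - 1), (2, 1), (2, - 1), (1, 1 + 2 * \<zeta>), (1, - (1 + 2 * \<zeta>))}"
    then have "x \<in> int_adjoin \<zeta> \<and> y \<in> int_adjoin \<zeta>"
      and "x = 0 \<and> y\<^sup>2 = 1 \<or> x = 1 \<and> y\<^sup>2 = - 3 \<or> x = 2 \<and> y\<^sup>2 = 1"
      using R x0 x1 by blast+
    then show "(x, y) \<in> Y_points (int_adjoin \<zeta>)"
      unfolding Y_points_def by auto
  qed
qed

end
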